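(* Let $K=\mathbb{Q}(\sqrt{D})$ where $D\in\mathbb{Z}_{\ge2}$ is squarefree and $D\equiv 2,3 \pmod 4$. Then there exist infinitely many $n\in\mathbb{Z}_{\ge1}$ such that $p_K(n)$ is odd and infinitely many $n\in\mathbb{Z}_{\ge1}$ such that $p_K(n)$ is even.
   Context: $\mathcal{O}_K$ is the ring of integers of $K$ and $\mathcal{O}_K^+$ is the set of totally positive elements of $\mathcal{O}_K$ (elements $\gamma$ with $\gamma>0$ and $\gamma'>0$, where $'$ denotes Galois conjugation). A partition of $\alpha\in\mathcal{O}_K^+$ is an expression $\alpha=\alpha_1+\dots+\alpha_k$ with $k\ge1$ and all $\alpha_i\in\mathcal{O}_K^+$, the order of the summands being irrelevant; $p_K(\alpha)$ is the number of partitions of $\alpha$. *)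

theory Defs
  imports
    Complex_Main
    "HOL-Library.Multiset"
    "HOL-Computational_Algebra.Computational_Algebra"
begin

text \<open>
  For \<open>D \<ge> 2\<close> squarefree, the real quadratic field \<open>\<rat>(\<surd>D)\<close> is realised as a subset of the
  reals, so that an element is positive in the first embedding iff it is a positive real number.
\<close>

definition quad_field :: "int \<Rightarrow> real set" where
  "quad_field D = {a + b * sqrt (of_int D) | a b. a \<in> \<rat> \<and> b \<in> \<rat>}"

text \<open>
  Galois conjugation. The description is unique if \<open>x \<in> quad_field D\<close> and \<open>\<surd>D\<close> is irrational;
  see \<open>quad_conj_eq\<close> below.
\<close>

definition quad_conj :: "int \<Rightarrow> real \<Rightarrow> real" where
  "quad_conj D x =
     (THE y. \<exists>a\<in>\<rat>. \<exists>b\<in>\<rat>. x = a + b * sqrt (of_int D) \<and> y = a - b * sqrt (of_int D))"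

definition ring_of_integers :: "int \<Rightarrow> real set" where
  "ring_of_integers D = {x \<in> quad_field D. algebraic_int x}"

definition totally_positive_integers :: "int \<Rightarrow> real set" where
  "totally_positive_integers D = {x \<in> ring_of_integers D. x > 0 \<and> quad_conj D x > 0}"

text \<open>
  Unordered expressions are multisets of summands; \<open>k \<ge> 1\<close> says that the multiset is nonempty.
\<close>

definition partitions :: "int \<Rightarrow> real \<Rightarrow> real multiset set" where
  "partitions D \<alpha> =
     {M. M \<noteq> {#} \<and> set_mset M \<subseteq> totally_positive_integers D \<and> sum_mset M = \<alpha>}"

text \<open>
  For \<open>\<alpha>\<close> in \<open>\<rat>(\<surd>D)\<close>, \<open>D \<ge> 2\<close> squarefree, the set of partitions is finite (the summands
  lie in a bounded part of a lattice in the plane and have trace at least \<open>1\<close>), so that \<open>card\<close>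
  is the true number of partitions.
\<close>

definition num_partitions :: "int \<Rightarrow> real \<Rightarrow> nat" where
  "num_partitions D \<alpha> = card (partitions D \<alpha>)"

lemma sqrt_squarefree_irrational:
  fixes D :: int
  assumes "D \<ge> 2" "squarefree D"
  shows "sqrt (of_int D) \<notin> \<rat>"
proof
  assume "sqrt (of_int D) \<in> \<rat>"
  then have "sqrt (of_int D) \<in> \<int>"
    using rational_algebraic_int_is_int algebraic_int_sqrt algebraic_int_of_int by blast
  then obtain k :: int where k: "sqrt (of_int D) = real_of_int k"
    by (auto elim: Ints_cases)
  have "real_of_int D = (sqrt (of_int D))\<^sup>2"
    using assms(1) by simp
  also have "\<dots> = of_int (k\<^sup>2)"
    by (simp add: k)
  finally have D: "D = k\<^sup>2"
    by linarith
  then have "k dvd 1"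
    using assms(2) by (auto simp: squarefree_def)
  then have "D = 1"
    using D by (auto simp: zdvd1_eq abs_if split: if_splits)
  with assms(1) show False
    by simp
qed

lemma quad_conj_eq:
  fixes D :: int and a b :: real
  assumes "D \<ge> 2" "squarefree D" and ab: "a \<in> \<rat>" "b \<in> \<rat>"
  shows "quad_conj D (a + b * sqrt (of_int D)) = a - b * sqrt (of_int D)"
proof -
  let ?s = "sqrt (of_int D)"
  have uniq: "c = a \<and> d = b"
    if "c \<in> \<rat>" "d \<in> \<rat>" and eq: "a + b * ?s = c + d * ?s" for c d
  proof -
    have "d = b"
    proof (rule ccontr)
      assume "d \<noteq> b"
      then have "?s = (a - c) / (d - b)"
        using eq by (simp add: field_simps)
      also have "\<dots> \<in> \<rat>"
        using ab that(1,2) by (intro Rats_divide Rats_diff)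
      finally show False
        using sqrt_squarefree_irrational[OF assms(1,2)] by simp
    qed
    then show ?thesis
      using eq by simp
  qed
  show ?thesis
    unfolding quad_conj_def using ab by (intro the_equality) (use uniq in blast)+
qed

end

theory Submission
  imports Defs "HOL-Number_Theory.Cong"
begin

text \<open>
  Write \<open>p(n)\<close> for the number of partitions of \<open>n\<close>, with \<open>p(0) = 1\<close>. Every partition of \<open>n\<close> has
  half-traces of the summands adding up to \<open>n\<close>, and these half-traces are integers because
  \<open>D \<equiv> 2, 3 (mod 4)\<close>. Counting the pairs of a partition and a summand, weighted by the half-trace,
  expresses \<open>n p(n)\<close> as a sum over totally positive \<open>\<alpha>\<close> and \<open>k \<ge> 1\<close> of half the trace of \<open>\<alpha>\<close> times
  the number of partitions of \<open>n - k \<alpha>\<close>. Modulo 2 the irrational \<open>\<alpha>\<close> cancel against their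
  conjugates, which leaves \<open>n p(n) \<equiv> \<Sum>\<^sub>j \<sigma>(j) p(n - j)\<close>, the recurrence of the ordinary partition
  function. Now \<open>\<sigma>\<close> is even on arbitrarily long intervals, by the Chinese remainder theorem, while
  \<open>\<sigma>(2\<^sup>k)\<close> is odd. If \<open>p\<close> were eventually even, such an interval would force \<open>\<sigma>\<close> to be even from
  there on; if \<open>p\<close> were eventually odd, the recurrences for two consecutive \<open>n\<close> at the end of such
  an interval would have equal right-hand sides modulo 2 and left-hand sides \<open>n\<close> and \<open>n + 1\<close>.
\<close>

section \<open>The parity of the divisor sum\<close>

definition divisor_sum :: "nat \<Rightarrow> nat" where
  "divisor_sum n = \<Sum>{d. d dvd n}"

lemma odd_divisor_sum_power_2: "odd (divisor_sum (2 ^ k))"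
proof -
  have eq: "{d::nat. d dvd 2 ^ k} = (\<lambda>i. 2 ^ i) ` {..k}"
    by (auto simp: divides_primepow_nat)
  have "divisor_sum (2 ^ k) = (\<Sum>i\<le>k. 2 ^ i)"
    unfolding divisor_sum_def eq by (subst sum.reindex) (auto simp: inj_on_def)
  also have "odd \<dots>"
    by (induction k) auto
  finally show ?thesis .
qed

text \<open>Writing \<open>n = q * m\<close> with \<open>q\<close> prime to \<open>m\<close>, the
  divisors of \<open>n\<close> are the \<open>d\<close> and the \<open>q * d\<close> for
  \<open>d\<close> dividing \<open>m\<close>. Hence sigma(n) = (1 + q) sigma(m), and 1 + q is
  even.\<close>

lemma even_divisor_sum:
  fixes q n :: nat
  assumes "prime q" "odd q" "q dvd n" "\<not> q\<^sup>2 dvd n"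
  shows "even (divisor_sum n)"
proof -
  obtain m where m: "n = q * m"
    using assms(3) by blast
  have qm: "\<not> q dvd m"
    using assms(4) by (auto simp: m power2_eq_square)
  have q0: "q > 0" using assms(1) prime_gt_0_nat by blast
  have m0: "m > 0" using qm by (cases m) auto
  have eq: "{d. d dvd n} = {d. d dvd m} \<union> (*) q ` {d. d dvd m}"
  proof (intro equalityI subsetI)
    fix d assume "d \<in> {d. d dvd n}"
    then have d: "d dvd q * m" by (simp add: m)
    show "d \<in> {d. d dvd m} \<union> (*) q ` {d. d dvd m}"
    proof (cases "q dvd d")
      case True
      then show ?thesis using d q0 by (auto simp: dvd_def)
    next
      case False
      then have "coprime d q"
        using assms(1) prime_imp_coprime coprime_commute by blast
      then show ?thesis using d coprime_dvd_mult_right_iff by blast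
    qed
  qed (auto simp: m)
  have "divisor_sum n = \<Sum>{d. d dvd m} + \<Sum>((*) q ` {d. d dvd m})"
    unfolding divisor_sum_def eq using m0 qm
    by (intro sum.union_disjoint) (auto dest: dvd_trans[of q])
  also have "\<Sum>((*) q ` {d. d dvd m}) = q * \<Sum>{d. d dvd m}"
    using q0 by (subst sum.reindex) (auto simp: inj_on_def sum_distrib_left)
  finally show ?thesis using assms(2) by simp
qed

text \<open>The Chinese remainder theorem makes each of \<open>L\<close> consecutive numbers
  divisible exactly once by an odd prime of its own.\<close>

lemma even_divisor_sum_gap:
  "\<exists>n\<ge>M. \<forall>j. n \<le> j \<and> j < n + L \<longrightarrow> even (divisor_sum j)"
proof (cases "L = 0")
  case True
  then show ?thesis by auto
next
  case False
  \<comment> \<open>Primes above 2 are odd; primes above \<open>M\<close> will force the start of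
    the interval beyond \<open>M\<close>.\<close>
  define S :: "nat set" where "S = {p. prime p} - {..M + L + 2}"
  have infS: "infinite S"
    unfolding S_def using primes_infinite by (intro Diff_infinite_finite) auto
  define q where "q = enumerate S"
  have qS: "q i \<in> S" for i
    unfolding q_def using infS enumerate_in_set by blast
  have q: "prime (q i)" "q i > M + L" "odd (q i)" for i
    using qS[of i] prime_odd_nat[of "q i"] by (auto simp: S_def)
  have inj: "q i \<noteq> q j" if "i \<noteq> j" for i j
    unfolding q_def using that infS by (metis enumerate_mono less_irrefl linorder_neqE_nat)
  \<comment> \<open>The summand \<open>((q i)\<^sup>2 - 1) * i\<close> stands for \<open>- i\<close>
    modulo \<open>(q i)\<^sup>2\<close>, so that the congruence stays within the naturals.\<close>
  have "\<exists>x. \<forall>i\<in>{..<L}. [x = q i + ((q i)\<^sup>2 - 1) * i] (mod (q i)\<^sup>2)"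
  proof (rule chinese_remainder_nat)
    show "\<forall>i\<in>{..<L}. \<forall>j\<in>{..<L}. i \<noteq> j \<longrightarrow> coprime ((q i)\<^sup>2) ((q j)\<^sup>2)"
      using inj q(1) primes_coprime by (metis coprime_power_left_iff coprime_power_right_iff)
  qed auto
  then obtain x where x: "\<And>i. i < L \<Longrightarrow> [x = q i + ((q i)\<^sup>2 - 1) * i] (mod (q i)\<^sup>2)"
    by auto
  have xi: "[x + i = q i] (mod (q i)\<^sup>2)" if "i < L" for i
  proof -
    have "(q i)\<^sup>2 \<ge> 1"
      using q(1) prime_gt_0_nat by (simp add: Suc_leI)
    then have "((q i)\<^sup>2 - 1) * i + i = (q i)\<^sup>2 * i"
      by (simp add: diff_mult_distrib)
    then have "[x + i = q i + (q i)\<^sup>2 * i] (mod (q i)\<^sup>2)"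
      using cong_add[OF x[OF that] cong_refl[of i]] by (simp add: add.assoc)
    then show ?thesis
      by (simp add: cong_def)
  qed
  have dvd: "q i dvd x + i" and ndvd: "\<not> (q i)\<^sup>2 dvd x + i" if "i < L" for i
  proof -
    have "[x + i = q i] (mod q i)"
      using xi[OF that] by (rule cong_dvd_modulus_nat) (simp add: power2_eq_square)
    then show "q i dvd x + i"
      by (simp add: cong_dvd_iff)
    have "\<not> (q i)\<^sup>2 dvd q i"
      using q(1)[of i] prime_gt_1_nat[of "q i"]
      by (auto simp: power2_eq_square dest!: dvd_imp_le)
    then show "\<not> (q i)\<^sup>2 dvd x + i"
      by (simp add: cong_dvd_iff[OF xi[OF that]])
  qed
  \<comment> \<open>Zero would be divisible by the square of \<open>q 0\<close>; so \<open>x\<close>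
    is a positive multiple of \<open>q 0\<close>, hence larger than \<open>M\<close>.\<close>
  have "x \<noteq> 0"
    using ndvd[of 0] False by (auto intro: Nat.gr0I)
  then have "q 0 \<le> x"
    using dvd[of 0] False by (auto dest: dvd_imp_le)
  moreover have "even (divisor_sum j)" if "x \<le> j" "j < x + L" for j
  proof -
    have "j - x < L" "x + (j - x) = j" using that by auto
    then show ?thesis
      using even_divisor_sum[OF q(1,3), of "j - x" j] dvd[of "j - x"] ndvd[of "j - x"] by simp
  qed
  ultimately show ?thesis
    using q(2)[of 0] by (intro exI[of _ x]) auto
qed

section \<open>Both parities occur infinitely often under the sigma recurrence\<close>

lemma even_sum_iff_of_even_iff:
  fixes f g :: "'a \<Rightarrow> nat"
  assumes "finite A" "\<And>x. x \<in> A \<Longrightarrow> even (f x) \<longleftrightarrow> even (g x)"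
  shows "even (sum f A) \<longleftrightarrow> even (sum g A)"
  using assms by (induction A rule: finite_induct) auto

lemma infinite_odd_even_of_recurrence:
  fixes p :: "nat \<Rightarrow> nat"
  assumes p0: "p 0 = 1"
    and rec: "\<And>n. even (n * p n) \<longleftrightarrow> even (\<Sum>j = 1..n. divisor_sum j * p (n - j))"
  shows "infinite {n. n \<ge> 1 \<and> odd (p n)}" "infinite {n. n \<ge> 1 \<and> even (p n)}"
proof -
  show "infinite {n. n \<ge> 1 \<and> odd (p n)}"
  proof
    assume "finite {n. n \<ge> 1 \<and> odd (p n)}"
    then obtain N where bound: "{n. n \<ge> 1 \<and> odd (p n)} \<subseteq> {..<N}"
      using finite_nat_bounded by blast
    have N: "even (p n)" if "n \<ge> N + 1" for n
    proof (rule ccontr)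
      assume "\<not> even (p n)"
      then have "n \<in> {n. n \<ge> 1 \<and> odd (p n)}" using that by simp
      then have "n \<in> {..<N}" using bound by blast
      then show False using that by simp
    qed
    obtain n where n: "n \<ge> N + 1" "\<And>j. n \<le> j \<Longrightarrow> j < n + N \<Longrightarrow> even (divisor_sum j)"
      using even_divisor_sum_gap by metis
    have ev: "even (divisor_sum j)" if "j \<ge> n" for j
      using that
    proof (induction j rule: less_induct)
      case (less j)
      show ?case
      proof (cases "j < n + N")
        case True
        then show ?thesis using n less.prems by blast
      next
        case False
        \<comment> \<open>In the recurrence at \<open>j\<close>, terms with \<open>i < n\<close> are
          even because \<open>j - i > N\<close>, those with \<open>n \<le> i < j\<close> by
          induction. The last term is sigma(j), as \<open>p 0 = 1\<close>.\<close>
        have "even (\<Sum>i = 1..j. divisor_sum i * p (j - i))"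
          using rec[of j] N[of j] n less.prems by simp
        moreover have "(\<Sum>i = 1..j. divisor_sum i * p (j - i))
            = divisor_sum j + (\<Sum>i = 1..<j. divisor_sum i * p (j - i))"
          using n less.prems p0 by (subst sum.last_plus) auto
        moreover have "even (divisor_sum i * p (j - i))" if "i \<in> {1..<j}" for i
          using that False N[of "j - i"] less.IH[of i] by (cases "i \<ge> n") auto
        then have "even (\<Sum>i = 1..<j. divisor_sum i * p (j - i))"
          by (intro dvd_sum) auto
        ultimately show ?thesis by simp
      qed
    qed
    have "n \<le> 2 ^ n" by (simp add: less_imp_le)
    then show False
      using ev odd_divisor_sum_power_2 by blast
  qed
  show "infinite {n. n \<ge> 1 \<and> even (p n)}"
  proof
    assume "finite {n. n \<ge> 1 \<and> even (p n)}"
    then obtain N where bound: "{n. n \<ge> 1 \<and> even (p n)} \<subseteq> {..<N}"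
      using finite_nat_bounded by blast
    have N: "odd (p n)" if "n \<ge> N + 1" for n
    proof (rule ccontr)
      assume "\<not> odd (p n)"
      then have "n \<in> {n. n \<ge> 1 \<and> even (p n)}" using that by simp
      then have "n \<in> {..<N}" using bound by blast
      then show False using that by simp
    qed
    \<comment> \<open>Length \<open>N + 2\<close> covers both \<open>m + N\<close> and
      \<open>m + N + 1\<close>. For either choice of \<open>n\<close>, an index \<open>j < m\<close>
      leaves \<open>n - j > N\<close>, where \<open>p\<close> is odd, while from \<open>m\<close> on
      sigma(j) is even.\<close>
    obtain m where m: "m \<ge> N + 1"
        "\<And>j. m \<le> j \<Longrightarrow> j < m + (N + 2) \<Longrightarrow> even (divisor_sum j)"
      using even_divisor_sum_gap by metis
    have par: "even n \<longleftrightarrow> even (\<Sum>j = 1..n. divisor_sum j)"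
      if n: "n = m + N \<or> n = m + N + 1" for n
    proof -
      have "even (divisor_sum j * p (n - j)) \<longleftrightarrow> even (divisor_sum j)" if "j \<in> {1..n}" for j
      proof (cases "j \<ge> m")
        case True
        then show ?thesis using that n m(2)[of j] by auto
      next
        case False
        then have "n - j \<ge> N + 1" using n by linarith
        then show ?thesis using N by simp
      qed
      then have "even (\<Sum>j = 1..n. divisor_sum j * p (n - j)) \<longleftrightarrow> even (\<Sum>j = 1..n. divisor_sum j)"
        by (intro even_sum_iff_of_even_iff) auto
      then show ?thesis
        using rec[of n] N[of n] n m(1) by auto
    qed
    \<comment> \<open>The two divisor sums differ by this even last term, yet \<open>m + N\<close>
      and \<open>m + N + 1\<close> have opposite parity.\<close>
    have "even (divisor_sum (m + N + 1))"
      using m by auto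
    then show False
      using par[of "m + N"] par[of "m + N + 1"] by auto
  qed
qed

section \<open>Integers of the real quadratic field\<close>

text \<open>In lowest terms \<open>y = r / t\<close>, every power of \<open>t\<close> divides the
  fixed number \<open>N\<close>, so \<open>t = 1\<close>. This will turn a common denominator for
  all powers of an algebraic integer into integrality of its norm.\<close>

lemma Ints_of_bounded_denominators:
  fixes y :: real and N :: int
  assumes "y \<in> \<rat>" "N > 0" and pow: "\<And>k. of_int N * y ^ k \<in> \<int>"
  shows "y \<in> \<int>"
proof -
  obtain r t :: int where rt: "t > 0" "coprime r t" "y = of_int r / of_int t"
    using assms(1) by (auto elim: Rats_cases')
  have dvd: "t ^ k dvd N" for k
  proof -
    obtain m :: int where "of_int N * y ^ k = of_int m"
      using pow Ints_cases by metis
    then have "real_of_int (N * r ^ k) = of_int (m * t ^ k)"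
      using rt by (simp add: power_divide field_simps)
    then have "N * r ^ k = m * t ^ k"
      by (simp only: of_int_eq_iff)
    then have "t ^ k dvd N * r ^ k"
      by simp
    moreover have "coprime (t ^ k) (r ^ k)"
      using rt(2) by (simp add: coprime_commute)
    ultimately show ?thesis
      using coprime_dvd_mult_left_iff by blast
  qed
  have "t = 1"
  proof (rule ccontr)
    assume "t \<noteq> 1"
    \<comment> \<open>The exponent \<open>N\<close> itself already gives the contradiction
      \<open>2 ^ N \<le> N\<close>.\<close>
    then have "(2::int) ^ nat N \<le> t ^ nat N"
      using rt(1) by (intro power_mono) auto
    also have "\<dots> \<le> N"
      using dvd assms(2) by (simp add: zdvd_imp_le)
    also have "N = int (nat N)"
      using assms(2) by simp
    also have "\<dots> < int (2 ^ nat N)"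
      by (subst of_nat_less_iff) (rule less_exp)
    finally show False by simp
  qed
  then show ?thesis using rt(3) by simp
qed

section \<open>Sums over multisets and sums invariant under an involution\<close>

lemma sum_mset_eq_sum_count:
  fixes f :: "'a \<Rightarrow> nat"
  assumes "finite A" "set_mset M \<subseteq> A"
  shows "(\<Sum>x\<in>#M. f x) = (\<Sum>x\<in>A. count M x * f x)"
  using assms(2)
proof (induction M)
  case (add y M)
  have "(\<Sum>x\<in>A. count (add_mset y M) x * f x)
      = (\<Sum>x\<in>A. count M x * f x + (if x = y then f x else 0))"
    by (intro sum.cong) auto
  also have "\<dots> = (\<Sum>x\<in>#M. f x) + f y"
    using add assms(1) by (simp add: sum.distrib)
  finally show ?case by simp
qed simp

text \<open>Points moved by \<open>c\<close> come in pairs with equal values. The linear order picks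
  one point of each pair.\<close>

lemma even_sum_involution:
  fixes g :: "'a::linorder \<Rightarrow> nat"
  assumes fin: "finite A" and c: "\<And>x. x \<in> A \<Longrightarrow> c x \<in> A" "\<And>x. x \<in> A \<Longrightarrow> c (c x) = x"
    and g: "\<And>x. x \<in> A \<Longrightarrow> g (c x) = g x"
  shows "even (sum g A) \<longleftrightarrow> even (sum g {x \<in> A. c x = x})"
proof -
  have A: "A = {x \<in> A. c x = x} \<union> ({x \<in> A. c x < x} \<union> {x \<in> A. x < c x})"
    by auto
  have "sum g A = sum g {x \<in> A. c x = x} + (sum g {x \<in> A. c x < x} + sum g {x \<in> A. x < c x})"
    by (subst A, subst sum.union_disjoint, (use fin in auto)[3], subst sum.union_disjoint)
       (use fin in auto)
  also have "sum g {x \<in> A. c x < x} = sum g {x \<in> A. x < c x}"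
    by (rule sum.reindex_bij_witness[of _ c c]) (auto simp: c g)
  finally show ?thesis by simp
qed

section \<open>Conjugation of a + b sqrt D\<close>

locale real_quadratic =
  fixes D :: int
  assumes D_ge_2: "D \<ge> 2" and squarefree_D: "squarefree D"
    and D_mod_4: "D mod 4 = 2 \<or> D mod 4 = 3"
begin

abbreviation rD :: real where "rD \<equiv> sqrt (of_int D)"
abbreviation conj :: "real \<Rightarrow> real" where "conj \<equiv> quad_conj D"
abbreviation T :: "real set" where "T \<equiv> totally_positive_integers D"

lemma rD_irrational: "rD \<notin> \<rat>"
  using sqrt_squarefree_irrational D_ge_2 squarefree_D by blast

lemma rD_sq: "rD * rD = of_int D"
  using D_ge_2 by simp

lemma rD_gt_1: "rD > 1"
  using D_ge_2 by simp

lemma rat_rD_eq_iff: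
  assumes "a \<in> \<rat>" "b \<in> \<rat>" "c \<in> \<rat>" "d \<in> \<rat>"
  shows "a + b * rD = c + d * rD \<longleftrightarrow> a = c \<and> b = d"
proof
  assume eq: "a + b * rD = c + d * rD"
  have "b = d"
  proof (rule ccontr)
    assume "b \<noteq> d"
    then have "rD = (c - a) / (b - d)"
      using eq by (simp add: field_simps)
    also have "\<dots> \<in> \<rat>"
      using assms by (intro Rats_divide Rats_diff)
    finally show False using rD_irrational by simp
  qed
  then show "a = c \<and> b = d" using eq by simp
qed auto

text \<open>Conjugation is a ring automorphism fixing the integers, so it commutes with evaluation;
  Horner's scheme carries both values along.\<close>

lemma poly_conj:
  fixes p :: "real poly"
  assumes "\<forall>i. coeff p i \<in> \<int>" and ab: "a \<in> \<rat>" "b \<in> \<rat>"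
  shows "\<exists>u\<in>\<rat>. \<exists>v\<in>\<rat>. poly p (a + b * rD) = u + v * rD \<and> poly p (a - b * rD) = u - v * rD"
  using assms(1)
proof (induction p)
  case 0
  then show ?case by (auto intro!: bexI[of _ 0])
next
  case (pCons c p)
  have c: "c \<in> \<int>" and "\<forall>i. coeff p i \<in> \<int>"
    using pCons.prems by (metis coeff_pCons_0, metis coeff_pCons_Suc)
  then obtain u v where uv: "u \<in> \<rat>" "v \<in> \<rat>"
    "poly p (a + b * rD) = u + v * rD" "poly p (a - b * rD) = u - v * rD"
    using pCons.IH by blast
  have "c \<in> \<rat>" using c Ints_subset_Rats by blast
  then have "c + a * u + b * v * of_int D \<in> \<rat>" "a * v + b * u \<in> \<rat>"
    using uv ab by auto
  moreover have "poly (pCons c p) (a + b * rD) = (c + a * u + b * v * (rD * rD)) + (a * v + b * u) * rD"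
    by (simp add: uv algebra_simps)
  moreover have "poly (pCons c p) (a - b * rD) = (c + a * u + b * v * (rD * rD)) - (a * v + b * u) * rD"
    by (simp add: uv algebra_simps)
  ultimately show ?case
    unfolding rD_sq by blast
qed

text \<open>The conjugate is a root of the same monic integer polynomial.\<close>

lemma algebraic_int_conj:
  assumes "a \<in> \<rat>" "b \<in> \<rat>" "algebraic_int (a + b * rD)"
  shows "algebraic_int (a - b * rD)"
proof -
  obtain p where p: "lead_coeff p = 1" "\<forall>i. coeff p i \<in> \<int>" "poly p (a + b * rD) = 0"
    using assms(3) by (auto simp: algebraic_int.simps)
  obtain u v where uv: "u \<in> \<rat>" "v \<in> \<rat>"
    "poly p (a + b * rD) = u + v * rD" "poly p (a - b * rD) = u - v * rD"
    using poly_conj[OF p(2) assms(1,2)] by blast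
  have "u = 0 \<and> v = 0"
    using rat_rD_eq_iff[of u v 0 0] uv p(3) by simp
  then have "poly p (a - b * rD) = 0" using uv(4) by simp
  then show ?thesis using p by (auto simp: algebraic_int.simps)
qed

section \<open>The ring of integers lies in Z + Z sqrt D\<close>

definition lattice :: "real set" where
  "lattice = {of_int a + of_int b * rD | a b. True}"

lemma lattice_add: "x \<in> lattice \<Longrightarrow> y \<in> lattice \<Longrightarrow> x + y \<in> lattice"
proof -
  assume "x \<in> lattice" "y \<in> lattice"
  then obtain a b c d :: int where "x = of_int a + of_int b * rD" "y = of_int c + of_int d * rD"
    by (auto simp: lattice_def)
  then have "x + y = of_int (a + c) + of_int (b + d) * rD" by (simp add: algebra_simps)
  then show ?thesis unfolding lattice_def by blast
qed

lemma lattice_int_mult: "m \<in> \<int> \<Longrightarrow> x \<in> lattice \<Longrightarrow> m * x \<in> lattice"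
proof -
  assume "m \<in> \<int>" "x \<in> lattice"
  then obtain k a b :: int where "m = of_int k" "x = of_int a + of_int b * rD"
    by (auto simp: lattice_def elim: Ints_cases)
  then have "m * x = of_int (k * a) + of_int (k * b) * rD" by (simp add: algebra_simps)
  then show ?thesis unfolding lattice_def by blast
qed

lemma lattice_0: "0 \<in> lattice"
  unfolding lattice_def by (auto intro!: exI[of _ 0])

lemma lattice_sum: "(\<And>i. i \<in> A \<Longrightarrow> f i \<in> lattice) \<Longrightarrow> sum f A \<in> lattice"
  by (induction A rule: infinite_finite_induct) (auto intro: lattice_add lattice_0)

lemma common_denominator:
  assumes "a \<in> \<rat>" "b \<in> \<rat>"
  shows "\<exists>N::int. N > 0 \<and> of_int N * (a + b * rD) \<in> lattice"
proof -
  obtain r t :: int where a: "t > 0" "a = of_int r / of_int t"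
    using assms(1) by (auto elim: Rats_cases')
  obtain r' t' :: int where b: "t' > 0" "b = of_int r' / of_int t'"
    using assms(2) by (auto elim: Rats_cases')
  have "of_int (t * t') * (a + b * rD) = of_int (r * t') + of_int (r' * t) * rD"
    using a b by (simp add: field_simps)
  then show ?thesis
    using mult_pos_pos[OF a(1) b(1)] unfolding lattice_def by blast
qed

lemma power_conj:
  assumes "a \<in> \<rat>" "b \<in> \<rat>"
  shows "\<exists>u\<in>\<rat>. \<exists>v\<in>\<rat>. (a + b * rD) ^ k = u + v * rD \<and> (a - b * rD) ^ k = u - v * rD"
  using poly_conj[of "monom 1 k", OF _ assms] by (auto simp: poly_monom coeff_monom)

text \<open>Z[x] is generated additively by the powers below the degree of a monic equation for x,
  so a common denominator of these finitely many powers serves for all.\<close>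

lemma algebraic_int_power_denominators:
  assumes ab: "a \<in> \<rat>" "b \<in> \<rat>" and alg: "algebraic_int (a + b * rD)"
  shows "\<exists>N::int. N > 0 \<and> (\<forall>k. of_int N * (a + b * rD) ^ k \<in> lattice)"
proof -
  define x where "x = a + b * rD"
  obtain p where p: "lead_coeff p = 1" "\<forall>i. coeff p i \<in> \<int>" "poly p x = 0"
    using alg by (auto simp: algebraic_int.simps x_def)
  define n where "n = degree p"
  have "\<exists>N::int. N > 0 \<and> of_int N * x ^ k \<in> lattice" for k
    using power_conj[OF ab] common_denominator unfolding x_def by metis
  then obtain N :: "nat \<Rightarrow> int" where N: "\<And>k. N k > 0" "\<And>k. of_int (N k) * x ^ k \<in> lattice"
    by metis
  define M where "M = prod N {..<n}"
  have M: "of_int M * x ^ k \<in> lattice" for k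
  proof (induction k rule: less_induct)
    case (less k)
    show ?case
    proof (cases "k < n")
      case True
      then have "M = prod N ({..<n} - {k}) * N k"
        unfolding M_def by (subst prod.remove[of _ k]) auto
      then have "of_int M * x ^ k = of_int (prod N ({..<n} - {k})) * (of_int (N k) * x ^ k)"
        by simp
      then show ?thesis by (simp only:) (intro lattice_int_mult N(2) Ints_of_int)
    next
      case False
      have "0 = (\<Sum>i\<le>n. coeff p i * x ^ i)"
        using p(3) by (simp add: poly_altdef n_def)
      also have "\<dots> = (\<Sum>i<n. coeff p i * x ^ i) + x ^ n"
        using p(1) by (simp add: n_def lessThan_Suc_atMost[symmetric])
      finally have "x ^ n = (\<Sum>i<n. - coeff p i * x ^ i)"
        by (simp add: sum_negf)
      \<comment> \<open>The monic equation times \<open>x ^ (k - n)\<close> involves only exponents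
        \<open>i + (k - n) < k\<close>, to which the induction hypothesis applies.\<close>
      then have "of_int M * (x ^ n * x ^ (k - n)) = (\<Sum>i<n. - coeff p i * (of_int M * x ^ (i + (k - n))))"
        by (simp add: sum_distrib_left sum_distrib_right power_add mult_ac)
      moreover have "x ^ n * x ^ (k - n) = x ^ k"
        using False by (simp flip: power_add)
      moreover have "(\<Sum>i<n. - coeff p i * (of_int M * x ^ (i + (k - n)))) \<in> lattice"
        using p(2) False by (intro lattice_sum lattice_int_mult less) auto
      ultimately show ?thesis by simp
    qed
  qed
  moreover have "M > 0" unfolding M_def using N(1) by (simp add: prod_pos)
  ultimately show ?thesis unfolding x_def by blast
qed

text \<open>By multiplicativity, \<open>N\<^sup>2\<close> times the k-th power of the norm is the
  norm of a lattice element, hence an integer; so the powers of the norm have bounded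
  denominators.\<close>

lemma norm_in_Ints:
  assumes ab: "a \<in> \<rat>" "b \<in> \<rat>" and "N > 0" "\<And>k. of_int N * (a + b * rD) ^ k \<in> lattice"
  shows "a\<^sup>2 - of_int D * b\<^sup>2 \<in> \<int>"
proof (rule Ints_of_bounded_denominators)
  show "a\<^sup>2 - of_int D * b\<^sup>2 \<in> \<rat>" using ab by simp
  show "N\<^sup>2 > 0" using assms(3) by simp
  fix k
  obtain u v where uv: "u \<in> \<rat>" "v \<in> \<rat>"
    "(a + b * rD) ^ k = u + v * rD" "(a - b * rD) ^ k = u - v * rD"
    using power_conj[OF ab] by blast
  obtain r t :: int where "of_int N * (a + b * rD) ^ k = of_int r + of_int t * rD"
    using assms(4)[of k] by (auto simp: lattice_def)
  then have "of_int N * u + (of_int N * v) * rD = of_int r + of_int t * rD"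
    by (simp add: uv algebra_simps)
  then have rt: "of_int N * u = of_int r" "of_int N * v = of_int t"
    by (subst (asm) rat_rD_eq_iff; use uv in simp)+
  have "(a + b * rD) * (a - b * rD) = a\<^sup>2 - (rD * rD) * b\<^sup>2"
    by (simp add: algebra_simps power2_eq_square)
  then have "a\<^sup>2 - of_int D * b\<^sup>2 = (a + b * rD) * (a - b * rD)"
    by (simp only: rD_sq)
  then have "of_int (N\<^sup>2) * (a\<^sup>2 - of_int D * b\<^sup>2) ^ k
      = (of_int N * (u + v * rD)) * (of_int N * (u - v * rD))"
    by (simp add: power_mult_distrib uv power2_eq_square)
  also have "\<dots> = (of_int N * u)\<^sup>2 - (rD * rD) * (of_int N * v)\<^sup>2"
    by (simp add: algebra_simps power2_eq_square)
  also have "\<dots> = of_int (r\<^sup>2 - D * t\<^sup>2)"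
    unfolding rt rD_sq by simp
  finally show "of_int (N\<^sup>2) * (a\<^sup>2 - of_int D * b\<^sup>2) ^ k \<in> \<int>"
    by simp
qed

text \<open>Trace and norm are integers. Then squarefreeness of \<open>D\<close> makes
  \<open>2 * b\<close> an integer, and the residue of \<open>D\<close> modulo 4 makes both
  \<open>2 * a\<close> and \<open>2 * b\<close> even.\<close>

lemma ring_of_integers_subset_lattice:
  "ring_of_integers D \<subseteq> lattice"
proof
  fix x assume "x \<in> ring_of_integers D"
  then obtain a b where x: "x = a + b * rD" and ab: "a \<in> \<rat>" "b \<in> \<rat>" and alg: "algebraic_int (a + b * rD)"
    by (auto simp: ring_of_integers_def quad_field_def)
  obtain N :: int where N: "N > 0" "\<And>k. of_int N * (a + b * rD) ^ k \<in> lattice"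
    using algebraic_int_power_denominators[OF ab alg] by blast
  \<comment> \<open>The trace \<open>2a\<close> is an integer because the norms of \<open>x\<close> and \<open>x + 1\<close> are.\<close>
  have "of_int N * ((a + 1) + b * rD) ^ k \<in> lattice" for k
  proof -
    have "of_int N * ((a + 1) + b * rD) ^ k = of_int N * ((a + b * rD) + 1) ^ k"
      by (simp add: algebra_simps)
    \<comment> \<open>By the binomial theorem the denominator \<open>N\<close> also serves for the
      powers of x + 1.\<close>
    also have "\<dots> = (\<Sum>i\<le>k. of_nat (k choose i) * (of_int N * (a + b * rD) ^ i))"
      by (subst binomial_ring) (simp add: sum_distrib_left mult_ac)
    also have "\<dots> \<in> lattice"
      by (intro lattice_sum lattice_int_mult[OF _ N(2)]) auto
    finally show ?thesis .
  qed
  then have n1: "(a + 1)\<^sup>2 - of_int D * b\<^sup>2 \<in> \<int>"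
    using norm_in_Ints[of "a + 1" b N] ab N by simp
  have n0: "a\<^sup>2 - of_int D * b\<^sup>2 \<in> \<int>"
    using norm_in_Ints[of a b N] ab N by simp
  have "2 * a = ((a + 1)\<^sup>2 - of_int D * b\<^sup>2) - (a\<^sup>2 - of_int D * b\<^sup>2) - 1"
    by (simp add: power2_eq_square algebra_simps)
  then have "2 * a \<in> \<int>" by (metis Ints_1 Ints_diff n0 n1)
  then obtain t :: int where t: "2 * a = of_int t" by (auto elim: Ints_cases)
  obtain m :: int where m: "a\<^sup>2 - of_int D * b\<^sup>2 = of_int m" using n0 by (auto elim: Ints_cases)
  have DB: "of_int D * (2 * b)\<^sup>2 = real_of_int (t\<^sup>2 - 4 * m)"
    by (simp flip: t m add: power2_eq_square algebra_simps)
  have "2 * b \<in> \<rat>" using ab by simp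
  then obtain r q :: int where rq: "q > 0" "coprime r q" "2 * b = of_int r / of_int q"
    by (auto elim: Rats_cases')
  have "real_of_int (D * r\<^sup>2) = of_int ((t\<^sup>2 - 4 * m) * q\<^sup>2)"
    using DB rq(1) unfolding rq(3) by (simp add: field_simps)
  then have "D * r\<^sup>2 = (t\<^sup>2 - 4 * m) * q\<^sup>2"
    by (simp only: of_int_eq_iff)
  then have "q\<^sup>2 dvd D * r\<^sup>2" by simp
  moreover have "coprime (q\<^sup>2) (r\<^sup>2)"
    using rq(2) by (simp add: coprime_commute)
  ultimately have "q\<^sup>2 dvd D"
    using coprime_dvd_mult_left_iff by blast
  then have "q = 1"
    using squarefree_D rq(1) by (auto simp: squarefree_def)
  then have B: "2 * b = of_int r" using rq by simp
  have "real_of_int (D * r\<^sup>2) = of_int (t\<^sup>2 - 4 * m)"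
    using DB by (simp add: B)
  then have eq: "D * r\<^sup>2 = t\<^sup>2 - 4 * m" by (simp only: of_int_eq_iff)
  have sq: "z\<^sup>2 mod 4 = (if even z then 0 else 1)" for z :: int
  proof (cases "even z")
    case True
    then obtain y where "z = 2 * y" by (rule evenE)
    then have "z\<^sup>2 = 0 + 4 * y\<^sup>2" by (simp add: power2_eq_square)
    then show ?thesis using True by simp
  next
    case False
    then obtain y where "z = 2 * y + 1" by (rule oddE)
    then have "z\<^sup>2 = 1 + 4 * (y\<^sup>2 + y)" by (simp add: power2_eq_square algebra_simps)
    then show ?thesis using False by (simp only: mod_mult_self2) simp
  qed
  \<comment> \<open>Squares are 0 or 1 modulo 4. For odd \<open>r\<close> the left side would be 2
    or 3, so \<open>r\<close> is even, and then \<open>t\<close> is even.\<close>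
  have "(D mod 4) * (r\<^sup>2 mod 4) mod 4 = (t\<^sup>2 - 4 * m) mod 4"
    by (simp add: eq[symmetric] mod_mult_eq)
  also have "\<dots> = t\<^sup>2 mod 4"
    using mod_mult_self2[of "t\<^sup>2" 4 "- m"] by simp
  finally have "even r \<and> even t"
    using D_mod_4 unfolding sq by (elim disjE) (simp_all split: if_splits)
  then obtain r' t' where "r = 2 * r'" "t = 2 * t'" by (auto elim!: evenE)
  then have "a = of_int t'" "b = of_int r'" using t B by auto
  then show "x \<in> lattice" unfolding x lattice_def by blast
qed


section \<open>Totally positive integers and counting of expressions\<close>

text \<open>Half the trace; on totally positive integers the truncations change nothing.\<close>

definition height :: "real \<Rightarrow> nat" where
  "height x = nat \<lfloor>(x + conj x) / 2\<rfloor>"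

lemma conj_lattice: "conj (of_int a + of_int b * rD) = of_int a - of_int b * rD"
  using quad_conj_eq[OF D_ge_2 squarefree_D] by simp

text \<open>Total positivity of a + b sqrt D means |b| sqrt D < a, and sqrt D > 1. The bound on
  \<open>b\<close> yields finiteness for bounded height.\<close>

lemma totally_positive_cases:
  assumes "x \<in> T"
  obtains b :: int where "x = of_nat (height x) + of_int b * rD"
    "conj x = of_nat (height x) - of_int b * rD" "height x \<ge> 1" "\<bar>b\<bar> < int (height x)"
proof -
  obtain a b :: int where x: "x = of_int a + of_int b * rD"
    using assms ring_of_integers_subset_lattice
    by (auto simp: totally_positive_integers_def lattice_def)
  have c: "conj x = of_int a - of_int b * rD"
    using conj_lattice by (simp add: x)
  have h: "height x = nat a"
    unfolding height_def c by (simp add: x)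
  have pos: "of_int a + of_int b * rD > 0" "of_int a - of_int b * rD > 0"
    using assms by (auto simp: totally_positive_integers_def c simp flip: x)
  have "real_of_int \<bar>b\<bar> * 1 \<le> of_int \<bar>b\<bar> * rD"
    using rD_gt_1 by (intro mult_left_mono) auto
  also have "\<dots> < of_int a"
    using pos by (auto simp: abs_if)
  finally have "\<bar>b\<bar> < a" by simp
  moreover from this have "of_nat (height x) = real_of_int a" using h by simp
  ultimately show ?thesis
    using that[of b] x c h by simp
qed

lemma conj_totally_positive:
  assumes "x \<in> T"
  shows "conj x \<in> T" "conj (conj x) = x" "height (conj x) = height x"
proof -
  obtain b where b: "x = of_nat (height x) + of_int b * rD"
    "conj x = of_nat (height x) - of_int b * rD"
    using totally_positive_cases[OF assms] .
  show cc: "conj (conj x) = x"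
    using conj_lattice[of "int (height x)" "- b"] b by simp
  then show "height (conj x) = height x"
    by (simp add: height_def add.commute)
  have "algebraic_int (conj x)"
    using assms algebraic_int_conj[of "of_nat (height x)" "of_int b"] b
    by (simp add: totally_positive_integers_def ring_of_integers_def)
  moreover have "conj x \<in> quad_field D"
    unfolding quad_field_def b(2)
    by (intro CollectI exI[of _ "of_nat (height x)"] exI[of _ "of_int (- b)"]) simp
  ultimately show "conj x \<in> T"
    using assms cc by (simp add: totally_positive_integers_def ring_of_integers_def)
qed

lemma of_nat_totally_positive:
  assumes "n \<ge> 1"
  shows "real n \<in> T" "height (real n) = n" "conj (real n) = real n"
proof -
  show c: "conj (real n) = real n"
    using conj_lattice[of "int n" 0] by simp
  then show "height (real n) = n"
    by (simp add: height_def)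
  have "real n \<in> quad_field D"
    unfolding quad_field_def by (intro CollectI exI[of _ "real n"] exI[of _ 0]) simp
  then show "real n \<in> T"
    using assms c by (simp add: totally_positive_integers_def ring_of_integers_def)
qed

lemma conj_fixed_imp_height:
  assumes "x \<in> T" "conj x = x"
  shows "x = real (height x)"
proof -
  obtain b where "x = of_nat (height x) + of_int b * rD" "conj x = of_nat (height x) - of_int b * rD"
    using totally_positive_cases[OF assms(1)] .
  then show ?thesis using assms(2) by linarith
qed

lemma finite_totally_positive_height_le: "finite {x \<in> T. height x \<le> n}"
proof (rule finite_subset)
  show "{x \<in> T. height x \<le> n} \<subseteq> (\<lambda>(a, b). of_nat a + of_int b * rD) ` ({..n} \<times> {- int n..int n})"
  proof
    fix x assume x: "x \<in> {x \<in> T. height x \<le> n}"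
    then obtain b where "x = of_nat (height x) + of_int b * rD" "\<bar>b\<bar> < int (height x)"
      using totally_positive_cases by blast
    then show "x \<in> (\<lambda>(a, b). of_nat a + of_int b * rD) ` ({..n} \<times> {- int n..int n})"
      using x by (intro image_eqI[of _ _ "(height x, b)"]) auto
  qed
qed auto

text \<open>Heights and conjugates add up. Sharing one \<open>b\<close> lets the value of the sum
  determine both the total height and the sum of the conjugates.\<close>

lemma sum_mset_totally_positive:
  assumes "set_mset M \<subseteq> T"
  shows "\<exists>b::int. sum_mset M = of_nat (\<Sum>x\<in>#M. height x) + of_int b * rD
    \<and> sum_mset (image_mset conj M) = of_nat (\<Sum>x\<in>#M. height x) - of_int b * rD"
  using assms
proof (induction M)
  case empty
  then show ?case by (auto intro!: exI[of _ 0])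
next
  case (add x M)
  then obtain b where b: "sum_mset M = of_nat (\<Sum>x\<in>#M. height x) + of_int b * rD"
    "sum_mset (image_mset conj M) = of_nat (\<Sum>x\<in>#M. height x) - of_int b * rD"
    by auto
  have "x \<in> T" using add.prems by simp
  then obtain c where c: "x = of_nat (height x) + of_int c * rD"
    "conj x = of_nat (height x) - of_int c * rD"
    using totally_positive_cases by blast
  have "sum_mset (add_mset x M) = x + sum_mset M" by simp
  also have "\<dots> = of_nat (\<Sum>x\<in>#add_mset x M. height x) + of_int (b + c) * rD"
    by (subst c(1), subst b(1)) (simp add: algebra_simps del: of_nat_sum_mset)
  finally have 1: "sum_mset (add_mset x M) = \<dots>" .
  have "sum_mset (image_mset conj (add_mset x M)) = conj x + sum_mset (image_mset conj M)" by simp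
  also have "\<dots> = of_nat (\<Sum>x\<in>#add_mset x M. height x) - of_int (b + c) * rD"
    by (subst c(2), subst b(2)) (simp add: algebra_simps del: of_nat_sum_mset)
  finally show ?case using 1 by blast
qed

section \<open>Counting expressions as sums of totally positive integers\<close>

text \<open>Unlike \<^const>\<open>partitions\<close>, this admits the empty multiset, which represents \<open>0\<close>.\<close>

definition expressions :: "real \<Rightarrow> real multiset set" where
  "expressions y = {M. set_mset M \<subseteq> T \<and> sum_mset M = y}"

lemma lattice_eq_iff:
  "real n + of_int b * rD = real n' + of_int b' * rD \<longleftrightarrow> n = n' \<and> b = b'"
  by (simp only: rat_rD_eq_iff Rats_of_nat Rats_of_int of_nat_eq_iff of_int_eq_iff)

lemma sum_height_expressions:
  assumes "M \<in> expressions (real n + of_int b * rD)"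
  shows "(\<Sum>x\<in>#M. height x) = n" "sum_mset (image_mset conj M) = real n - of_int b * rD"
proof -
  have M: "set_mset M \<subseteq> T" "sum_mset M = real n + of_int b * rD"
    using assms by (auto simp: expressions_def)
  obtain b' where b': "sum_mset M = of_nat (\<Sum>x\<in>#M. height x) + of_int b' * rD"
    "sum_mset (image_mset conj M) = of_nat (\<Sum>x\<in>#M. height x) - of_int b' * rD"
    using sum_mset_totally_positive[OF M(1)] by blast
  have "(\<Sum>x\<in>#M. height x) = n \<and> b' = b"
    using b'(1) unfolding M(2) using lattice_eq_iff by metis
  then show "(\<Sum>x\<in>#M. height x) = n" "sum_mset (image_mset conj M) = real n - of_int b * rD"
    using b'(2) by auto
qed

text \<open>The heights are at least 1 and add up to \<open>n\<close>, which bounds each of them and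
  their number.\<close>

lemma height_le_expressions:
  assumes "M \<in> expressions (real n)"
  shows "set_mset M \<subseteq> {x \<in> T. height x \<le> n}" "size M \<le> n"
proof -
  have M: "set_mset M \<subseteq> T" and h: "(\<Sum>x\<in>#M. height x) = n"
    using assms sum_height_expressions(1)[of M n 0] by (auto simp: expressions_def)
  have "height x \<le> n" if x: "x \<in># M" for x
  proof -
    obtain M' where "M = add_mset x M'" using multi_member_split[OF x] by blast
    then show ?thesis using h by auto
  qed
  then show "set_mset M \<subseteq> {x \<in> T. height x \<le> n}" using M by auto
  have "size M = (\<Sum>x\<in>#M. 1)" by simp
  also have "\<dots> \<le> (\<Sum>x\<in>#M. height x)"
    using M totally_positive_cases by (intro sum_mset_mono) blast
  finally show "size M \<le> n" using h by simp
qed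

lemma finite_expressions: "finite (expressions (real n))"
proof (rule finite_subset)
  let ?A = "{x \<in> T. height x \<le> n}"
  show "expressions (real n) \<subseteq> mset ` {xs. set xs \<subseteq> ?A \<and> length xs \<le> n}"
  proof
    fix M assume M: "M \<in> expressions (real n)"
    obtain xs where "mset xs = M" using ex_mset by blast
    then show "M \<in> mset ` {xs. set xs \<subseteq> ?A \<and> length xs \<le> n}"
      using height_le_expressions[OF M] by (intro image_eqI[of _ _ xs]) auto
  qed
  show "finite (mset ` {xs. set xs \<subseteq> ?A \<and> length xs \<le> n})"
    using finite_lists_length_le[OF finite_totally_positive_height_le] by simp
qed

text \<open>Removing \<open>k\<close> copies of \<open>x\<close> is a bijection, with adding them
  back as inverse.\<close>

lemma card_expressions_count_ge:
  assumes "x \<in> T"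
  shows "card {M \<in> expressions y. k \<le> count M x} = card (expressions (y - real k * x))"
proof (rule bij_betw_same_card)
  show "bij_betw (\<lambda>M. M - replicate_mset k x) {M \<in> expressions y. k \<le> count M x}
          (expressions (y - real k * x))"
  proof (rule bij_betw_byWitness[of _ "\<lambda>M. M + replicate_mset k x"])
    show "(\<lambda>M. M - replicate_mset k x) ` {M \<in> expressions y. k \<le> count M x}
        \<subseteq> expressions (y - real k * x)"
    proof safe
      fix M assume M: "M \<in> expressions y" "k \<le> count M x"
      then have sub: "replicate_mset k x \<subseteq># M"
        by (simp add: count_le_replicate_mset_subset_eq)
      have "sum_mset (M - replicate_mset k x) + sum_mset (replicate_mset k x) = sum_mset M"
        by (simp only: sum_mset.union[symmetric] subset_mset.diff_add[OF sub])
      moreover have "set_mset (M - replicate_mset k x) \<subseteq> set_mset M"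
        by (auto dest: in_diffD)
      ultimately show "M - replicate_mset k x \<in> expressions (y - real k * x)"
        using M(1) unfolding expressions_def by auto
    qed
    show "(\<lambda>M. M + replicate_mset k x) ` expressions (y - real k * x)
        \<subseteq> {M \<in> expressions y. k \<le> count M x}"
      using assms by (auto simp: expressions_def split: if_splits)
  qed (simp_all add: count_le_replicate_mset_subset_eq)
qed

lemma card_expressions_conj:
  "card (expressions (real n - of_int b * rD)) = card (expressions (real n + of_int b * rD))"
proof -
  have maps: "image_mset conj M \<in> expressions (real n - of_int b * rD)
      \<and> image_mset conj (image_mset conj M) = M"
    if "M \<in> expressions (real n + of_int b * rD)" for M and b :: int
  proof -
    have M: "set_mset M \<subseteq> T" using that by (simp add: expressions_def)
    then have "image_mset conj (image_mset conj M) = image_mset (\<lambda>x. x) M"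
      unfolding multiset.map_comp
      using conj_totally_positive(2) by (intro image_mset_cong) auto
    then show ?thesis
      using M sum_height_expressions(2)[OF that] conj_totally_positive(1)
      by (auto simp: expressions_def)
  qed
  have "bij_betw (image_mset conj) (expressions (real n - of_int b * rD))
          (expressions (real n + of_int b * rD))"
    by (rule bij_betw_byWitness[of _ "image_mset conj"])
       (use maps[of _ "- b"] maps[of _ b] in auto)
  then show ?thesis by (rule bij_betw_same_card)
qed

text \<open>Agrees with \<open>num_partitions D\<close> at positive integers, but takes the value 1
  at 0, as the recurrence demands.\<close>

definition num_expressions :: "real \<Rightarrow> nat" where
  "num_expressions y = card (expressions y)"

lemma expressions_of_neg:
  assumes "y < 0"
  shows "expressions y = {}"
proof -
  have nonneg: "sum_mset M \<ge> 0" if "set_mset M \<subseteq> T" for M :: "real multiset"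
    using that by (induction M) (auto simp: totally_positive_integers_def)
  have "M \<notin> expressions y" for M
    using nonneg[of M] assms by (auto simp: expressions_def)
  then show ?thesis by (simp only: set_eq_iff empty_iff simp_thms not_False_eq_True)
qed

lemma num_expressions_0: "num_expressions 0 = 1"
proof -
  have "expressions 0 = {{#}}"
    using height_le_expressions(2)[of _ 0] by (auto simp: expressions_def)
  then show ?thesis by (simp add: num_expressions_def)
qed

lemma num_partitions_eq:
  assumes "n \<ge> 1"
  shows "num_partitions D (real n) = num_expressions (real n)"
proof -
  have "partitions D (real n) = expressions (real n)"
    using assms by (auto simp: partitions_def expressions_def)
  then show ?thesis by (simp add: num_partitions_def num_expressions_def)
qed

section \<open>The recurrence modulo 2\<close>

text \<open>Substitute \<open>j = k * m\<close>; terms with \<open>k * m > n\<close> vanish because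
  their argument is negative.\<close>

lemma sum_num_expressions_multiples:
  assumes "m \<ge> 1"
  shows "(\<Sum>k = 1..n. num_expressions (real n - real k * real m))
    = (\<Sum>j | j \<in> {1..n} \<and> m dvd j. num_expressions (real (n - j)))"
proof -
  have "(\<Sum>k = 1..n. num_expressions (real n - real k * real m))
      = (\<Sum>k | k \<in> {1..n} \<and> k * m \<le> n. num_expressions (real n - real k * real m))"
  proof (rule sum.mono_neutral_right)
    show "\<forall>k\<in>{1..n} - {k. k \<in> {1..n} \<and> k * m \<le> n}. num_expressions (real n - real k * real m) = 0"
    proof
      fix k assume "k \<in> {1..n} - {k. k \<in> {1..n} \<and> k * m \<le> n}"
      then have "real n < real (k * m)" by (subst of_nat_less_iff) auto
      then show "num_expressions (real n - real k * real m) = 0"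
        by (simp add: num_expressions_def expressions_of_neg)
    qed
  qed auto
  also have "\<dots> = (\<Sum>j | j \<in> {1..n} \<and> m dvd j. num_expressions (real (n - j)))"
  proof (rule sum.reindex_bij_witness[of _ "\<lambda>j. j div m" "\<lambda>k. k * m"])
    fix k assume "k \<in> {k. k \<in> {1..n} \<and> k * m \<le> n}"
    then show "k * m div m = k" "k * m \<in> {j. j \<in> {1..n} \<and> m dvd j}"
      "num_expressions (real (n - k * m)) = num_expressions (real n - real k * real m)"
      using assms by (auto simp: of_nat_diff)
  next
    fix j assume "j \<in> {j. j \<in> {1..n} \<and> m dvd j}"
    then obtain i where "j = i * m" "1 \<le> j" "j \<le> n"
      by (auto simp: mult.commute elim!: dvdE)
    then show "j div m * m = j" "j div m \<in> {k. k \<in> {1..n} \<and> k * m \<le> n}"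
      using assms by (auto intro: Suc_leI Nat.gr0I order_trans[of i "i * m" n])
  qed
  finally show ?thesis .
qed

text \<open>Double counting of the total height of all expressions of \<open>n\<close>: each has
  height \<open>n\<close>, and each \<open>x\<close> contributes its height times its
  multiplicity.\<close>

lemma sum_height_mult_num_expressions:
  "n * num_expressions (real n)
    = (\<Sum>x | x \<in> T \<and> height x \<le> n. height x * (\<Sum>k = 1..n. num_expressions (real n - real k * x)))"
proof -
  let ?E = "expressions (real n)" and ?A = "{x. x \<in> T \<and> height x \<le> n}"
  have count: "(\<Sum>M\<in>?E. count M x) = (\<Sum>k = 1..n. num_expressions (real n - real k * x))"
    if "x \<in> T" for x
  proof -
    \<comment> \<open>A multiplicity is the number of \<open>k \<ge> 1\<close> not exceeding it, and
      \<open>k \<le> n\<close> suffices since an expression of \<open>n\<close> has at most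
      \<open>n\<close> summands.\<close>
    have "(\<Sum>M\<in>?E. count M x) = (\<Sum>M\<in>?E. \<Sum>k = 1..n. if k \<le> count M x then 1 else 0)"
    proof (rule sum.cong)
      fix M assume "M \<in> ?E"
      then have "count M x \<le> n"
        using height_le_expressions(2) count_le_size[of M x] by (meson order_trans)
      then have "{1..n} \<inter> {k. k \<le> count M x} = {1..count M x}" by auto
      then show "count M x = (\<Sum>k = 1..n. if k \<le> count M x then 1 else 0)"
        by (simp add: sum.If_cases)
    qed simp
    also have "\<dots> = (\<Sum>k = 1..n. \<Sum>M\<in>?E. if k \<le> count M x then 1 else 0)"
      by (rule sum.swap)
    also have "\<dots> = (\<Sum>k = 1..n. card {M \<in> ?E. k \<le> count M x})"
      using finite_expressions by (simp add: sum.If_cases Int_def)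
    also have "\<dots> = (\<Sum>k = 1..n. num_expressions (real n - real k * x))"
      using card_expressions_count_ge[OF that] by (simp add: num_expressions_def)
    finally show ?thesis .
  qed
  have "n * num_expressions (real n) = (\<Sum>M\<in>?E. n)"
    by (simp add: num_expressions_def)
  also have "\<dots> = (\<Sum>M\<in>?E. \<Sum>x\<in>?A. count M x * height x)"
  proof (rule sum.cong)
    fix M assume M: "M \<in> ?E"
    have "n = (\<Sum>x\<in>#M. height x)"
      using sum_height_expressions(1)[of M n 0] M by simp
    also have "\<dots> = (\<Sum>x\<in>?A. count M x * height x)"
      using finite_totally_positive_height_le height_le_expressions(1)[OF M]
      by (rule sum_mset_eq_sum_count)
    finally show "n = (\<Sum>x\<in>?A. count M x * height x)" .
  qed simp
  also have "\<dots> = (\<Sum>x\<in>?A. height x * (\<Sum>M\<in>?E. count M x))"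
    by (subst sum.swap) (simp add: sum_distrib_left mult.commute)
  also have "\<dots> = (\<Sum>x\<in>?A. height x * (\<Sum>k = 1..n. num_expressions (real n - real k * x)))"
    using count by (intro sum.cong) auto
  finally show ?thesis .
qed

lemma num_expressions_conj:
  assumes "x \<in> T"
  shows "num_expressions (real n - real k * conj x) = num_expressions (real n - real k * x)"
proof -
  obtain b where b: "x = of_nat (height x) + of_int b * rD"
    "conj x = of_nat (height x) - of_int b * rD"
    using totally_positive_cases[OF assms] .
  show ?thesis
  \<comment> \<open>With nonnegative half-trace the two arguments are conjugate lattice elements.
    Otherwise both have negative half-trace, hence no expressions, although one of them may be a
    positive real.\<close>
  proof (cases "k * height x \<le> n")
    case True
    have "real n - real k * conj x = real (n - k * height x) + of_int (int k * b) * rD"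
      "real n - real k * x = real (n - k * height x) - of_int (int k * b) * rD"
      using arg_cong[OF b(1), of "(*) (real k)"] arg_cong[OF b(2), of "(*) (real k)"] True
      by (simp_all add: of_nat_diff algebra_simps)
    then show ?thesis
      using card_expressions_conj by (simp only: num_expressions_def)
  next
    case False
    have "expressions (real n - real k * z) = {}"
      if "z = of_nat (height x) + of_int c * rD" for z and c :: int
    proof -
      have "M \<notin> expressions (real n - real k * z)" for M
      proof
        assume M: "M \<in> expressions (real n - real k * z)"
        then have "set_mset M \<subseteq> T" by (simp add: expressions_def)
        then obtain d where "sum_mset M = of_nat (\<Sum>x\<in>#M. height x) + of_int d * rD"
          using sum_mset_totally_positive by blast
        then have "real n - real k * z = of_nat (\<Sum>x\<in>#M. height x) + of_int d * rD"
          using M by (simp add: expressions_def)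
        then have "real n + of_int 0 * rD
            = real (k * height x + (\<Sum>x\<in>#M. height x)) + of_int (int k * c + d) * rD"
          by (simp add: that algebra_simps del: of_nat_sum_mset)
        then have "n = k * height x + (\<Sum>x\<in>#M. height x)"
          using lattice_eq_iff by blast
        then show False using False by simp
      qed
      then show ?thesis by blast
    qed
    from this[of x b] this[of "conj x" "- b"] show ?thesis
      using b by (simp add: num_expressions_def)
  qed
qed

lemma num_expressions_recurrence:
  "even (n * num_expressions (real n))
    \<longleftrightarrow> even (\<Sum>j = 1..n. divisor_sum j * num_expressions (real (n - j)))"
proof -
  define g where "g x = height x * (\<Sum>k = 1..n. num_expressions (real n - real k * x))" for x
  let ?A = "{x. x \<in> T \<and> height x \<le> n}"
  have "even (n * num_expressions (real n)) \<longleftrightarrow> even (sum g ?A)"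
    unfolding g_def sum_height_mult_num_expressions ..
  \<comment> \<open>Conjugation preserves \<open>g\<close>, so modulo 2 only its fixed points, the
    integers from 1 to \<open>n\<close>, remain.\<close>
  also have "\<dots> \<longleftrightarrow> even (sum g {x \<in> ?A. conj x = x})"
    using conj_totally_positive finite_totally_positive_height_le
    by (intro even_sum_involution) (auto simp: g_def num_expressions_conj)
  also have "{x \<in> ?A. conj x = x} = real ` {1..n}"
  proof (intro equalityI subsetI)
    fix x assume x: "x \<in> {x \<in> ?A. conj x = x}"
    then have "x = real (height x)" "height x \<ge> 1"
      using conj_fixed_imp_height totally_positive_cases by blast+
    then show "x \<in> real ` {1..n}" using x by (intro image_eqI[of _ _ "height x"]) auto
  qed (use of_nat_totally_positive in auto)
  also have "sum g (real ` {1..n}) = (\<Sum>m = 1..n. g (real m))"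
    by (subst sum.reindex) auto
  also have "\<dots> = (\<Sum>m = 1..n. m * (\<Sum>j | j \<in> {1..n} \<and> m dvd j. num_expressions (real (n - j))))"
  proof (rule sum.cong)
    fix m assume "m \<in> {1..n}"
    then have "m \<ge> 1" by simp
    then show "g (real m) = m * (\<Sum>j | j \<in> {1..n} \<and> m dvd j. num_expressions (real (n - j)))"
      unfolding g_def by (simp only: of_nat_totally_positive(2) sum_num_expressions_multiples)
  qed simp
  also have "\<dots> = (\<Sum>m = 1..n. \<Sum>j = 1..n. if m dvd j then m * num_expressions (real (n - j)) else 0)"
    unfolding sum_distrib_left by (intro sum.cong refl sum.inter_filter finite_atLeastAtMost)
  \<comment> \<open>Exchanging the sums collects, for each \<open>j\<close>, the divisors
    \<open>m\<close> of \<open>j\<close>; all of them lie in \<open>{1..n}\<close>, so they add up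
    to sigma(j).\<close>
  also have "\<dots> = (\<Sum>j = 1..n. \<Sum>m = 1..n. if m dvd j then m * num_expressions (real (n - j)) else 0)"
    by (rule sum.swap)
  also have "\<dots> = (\<Sum>j = 1..n. divisor_sum j * num_expressions (real (n - j)))"
  proof (rule sum.cong)
    fix j assume j: "j \<in> {1..n}"
    then have eq: "{m \<in> {1..n}. m dvd j} = {m. m dvd j}"
      by (auto simp: Suc_le_eq dvd_imp_le dest: dvd_imp_le order_trans intro: dvd_pos_nat)
    have "(\<Sum>m = 1..n. if m dvd j then m * num_expressions (real (n - j)) else 0)
        = (\<Sum>m | m \<in> {1..n} \<and> m dvd j. m * num_expressions (real (n - j)))"
      by (rule sum.inter_filter[symmetric]) simp
    then show "(\<Sum>m = 1..n. if m dvd j then m * num_expressions (real (n - j)) else 0)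
        = divisor_sum j * num_expressions (real (n - j))"
      unfolding divisor_sum_def eq sum_distrib_right by simp
  qed simp
  finally show ?thesis .
qed

end

theorem theorem1p2:
  fixes D :: int
  assumes "D \<ge> 2" and "squarefree D" and "D mod 4 = 2 \<or> D mod 4 = 3"
  shows "infinite {n :: nat. n \<ge> 1 \<and> odd (num_partitions D (of_nat n))} \<and>
         infinite {n :: nat. n \<ge> 1 \<and> even (num_partitions D (of_nat n))}"
proof -
  interpret real_quadratic D
    using assms by unfold_locales
  let ?p = "\<lambda>n. num_expressions (real n)"
  have "?p 0 = 1" by (simp add: num_expressions_0)
  note inf = infinite_odd_even_of_recurrence[of ?p, OF this num_expressions_recurrence]
  have "{n. n \<ge> 1 \<and> odd (?p n)} = {n. n \<ge> 1 \<and> odd (num_partitions D (of_nat n))}"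
    "{n. n \<ge> 1 \<and> even (?p n)} = {n. n \<ge> 1 \<and> even (num_partitions D (of_nat n))}"
    by (simp_all add: num_partitions_eq cong: conj_cong)
  then show ?thesis using inf by (simp only: simp_thms)
qed

end
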